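(* A function $f : \mathbb{R}^d \to \mathbb{R}^p$ is gauge-measurable if and only if, for every $\epsilon > 0$, there exists a closed set $C \subset \mathbb{R}^d$ such that the restriction $f|_C$ is continuous and the inner measure of the open set $\mathbb{R}^d \setminus C$ satisfies $\mu(\mathbb{R}^d \setminus C) \leq \epsilon$.
   Context: A gauge $\gamma$ on $\mathbb{R}^d$ is a function mapping each point $x \in \mathbb{R}^d$ to an open set $\gamma(x) \subset \mathbb{R}^d$ such that $x \in \gamma(x)$. A rectangle in $\mathbb{R}^d$ is a set of the form $R = [a_1,b_1) \times \cdots \times [a_d,b_d)$ with real numbers $a_1<b_1, \ldots, a_d<b_d$; its volume is $\operatorname{vol}(R) = (b_1-a_1)\cdots(b_d-a_d)$. A finite family of rectangles is disjoint if the rectangles are pairwise disjoint. Gauge measurability: a function $f : \mathbb{R}^d \to \mathbb{R}^p$ is gauge-measurable whenever, for every $\epsilon>0$ and every $\eta>0$, there exists a gauge $\gamma$ on $\mathbb{R}^d$ such that, for every finite family of disjoint rectangles $(R_i)_{i\in\{1,\ldots,k\}}$ in $\mathbb{R}^d$ and finite families of points $(c_i)_{i\in\{1,\ldots,k\}}$ and $(c'_i)_{i\in\{1,\ldots,k\}}$ in $\mathbb{R}^d$ satisfying $|f(c_i)-f(c'_i)| \geq \eta$ and $R_i \subset \gamma(c_i)\cap\gamma(c'_i)$ for every $i\in\{1,\ldots,k\}$, one has $\sum_{i=1}^k \operatorname{vol}(R_i) \leq \epsilon$. Inner measure: for an open set $U \subset \mathbb{R}^d$, $\mu(U) := \sup\left\{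 \sum_{i=1}^k \operatorname{vol}(R_i) \right\}$, the supremum (possibly $+\infty$) being taken over all finite disjoint families of rectangles $(R_i)_{i\in\{1,\ldots,k\}}$ such that the closure satisfies $\overline{R_i} \subset U$ for every $i$ (so $\mu(\emptyset)=0$). *)

theory Defs
  imports "HOL-Analysis.Analysis"
begin

text \<open>A rectangle is represented by its corner vectors, which it determines uniquely when they
  satisfy \<open>rectangle_corners\<close>; so volumes and families of rectangles are expressed on corners.
  The order is spelled out by coordinates because \<open><\<close> on vectors is not the coordinatewise strict
  order.\<close>

definition rectangle_corners :: "real ^ 'd \<Rightarrow> real ^ 'd \<Rightarrow> bool" where
  "rectangle_corners a b \<longleftrightarrow> (\<forall>j. a $ j < b $ j)"

definition rectangle :: "real ^ 'd \<Rightarrow> real ^ 'd \<Rightarrow> (real ^ 'd) set" where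
  "rectangle a b = {x. \<forall>j. a $ j \<le> x $ j \<and> x $ j < b $ j}"

definition vol :: "real ^ 'd \<Rightarrow> real ^ 'd \<Rightarrow> real" where
  "vol a b = (\<Prod>j\<in>UNIV. b $ j - a $ j)"

definition disjoint_rectangles ::
    "nat \<Rightarrow> (nat \<Rightarrow> real ^ 'd) \<Rightarrow> (nat \<Rightarrow> real ^ 'd) \<Rightarrow> bool" where
  "disjoint_rectangles k a b \<longleftrightarrow>
     (\<forall>i\<in>{1..k}. rectangle_corners (a i) (b i)) \<and>
     disjoint_family_on (\<lambda>i. rectangle (a i) (b i)) {1..k}"

definition gauge_measurable :: "(real ^ 'd \<Rightarrow> real ^ 'p) \<Rightarrow> bool" where
  "gauge_measurable f \<longleftrightarrow>
     (\<forall>\<epsilon>>0. \<forall>\<eta>>0. \<exists>\<gamma>. gauge \<gamma> \<and>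
        (\<forall>k a b c c'.
           disjoint_rectangles k a b \<and>
           (\<forall>i\<in>{1..k}. norm (f (c i) - f (c' i)) \<ge> \<eta> \<and>
                         rectangle (a i) (b i) \<subseteq> \<gamma> (c i) \<inter> \<gamma> (c' i))
           \<longrightarrow> (\<Sum>i=1..k. vol (a i) (b i)) \<le> \<epsilon>))"

text \<open>The empty family \<open>k = 0\<close> is admitted.  Volumes of rectangles are positive, so \<open>ennreal\<close>
  does not truncate the sums.\<close>

definition inner_measure :: "(real ^ 'd) set \<Rightarrow> ennreal" where
  "inner_measure U =
     Sup {ennreal (\<Sum>i=1..k. vol (a i) (b i)) | k a b.
            disjoint_rectangles k a b \<and> (\<forall>i\<in>{1..k}. closure (rectangle (a i) (b i)) \<subseteq> U)}"

end

theory Submission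
  imports Defs
begin

text \<open>For the gauge \<open>\<gamma>\<close> belonging to \<open>(\<epsilon>, \<eta>)\<close>, let \<open>U\<close> be the union of the open sets
  \<open>\<gamma> c \<inter> \<gamma> c'\<close> with \<open>norm (f c - f c') \<ge> \<eta>\<close>.  Cutting \<open>U\<close> into small boxes shows that its measure is
  at most \<open>\<epsilon>\<close>.  If \<open>x\<close> and \<open>y\<close> lie outside \<open>U\<close> and \<open>y \<in> \<gamma> x\<close>, then \<open>y \<in> \<gamma> x \<inter> \<gamma> y\<close> forces
  \<open>norm (f x - f y) < \<eta>\<close>; so removing the sets \<open>U\<close> for \<open>(\<epsilon>/2, 1), (\<epsilon>/4, 1/2), \<dots>\<close> leaves a closed
  set on which \<open>f\<close> is continuous.

  Conversely, given \<open>C\<close>, take for \<open>\<gamma> x\<close> the complement of \<open>C\<close> when \<open>x \<notin> C\<close>, and a neighbourhood on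
  which \<open>f\<close> varies by less than \<open>\<eta>/2\<close> along \<open>C\<close> when \<open>x \<in> C\<close>.  Every rectangle in
  the definition of gauge measurability then misses \<open>C\<close>.\<close>

section \<open>Half-open rectangles, boxes and their volumes\<close>

lemma box_subset_rectangle: "box a b \<subseteq> rectangle a b"
  by (auto simp: rectangle_def mem_box_cart intro: less_imp_le)

lemma rectangle_subset_cbox: "rectangle a b \<subseteq> cbox a b"
  unfolding rectangle_def mem_box_cart subset_iff mem_Collect_eq by (meson less_imp_le)

lemma sets_rectangle [simp]: "rectangle a b \<in> sets borel"
proof -
  have "rectangle a b = (\<Inter>j. {x. a $ j \<le> x $ j} \<inter> {x. x $ j < b $ j})"
    by (auto simp: rectangle_def)
  moreover have "\<dots> \<in> sets borel"
    by (intro sets.countable_INT'' sets.Int borel_closed borel_open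
        closed_halfspace_component_ge_cart open_halfspace_component_lt_cart)
       auto
  ultimately show ?thesis by simp
qed

lemma rectangle_corners_iff_box: "rectangle_corners a b \<longleftrightarrow> box a b \<noteq> {}"
  by (simp add: rectangle_corners_def interval_ne_empty_cart)

lemma vol_pos: "rectangle_corners a b \<Longrightarrow> 0 < vol a b"
  by (auto simp: rectangle_corners_def vol_def intro!: prod_pos)

lemma measure_cbox_eq_vol:
  assumes "rectangle_corners a b"
  shows "measure lborel (cbox a b) = vol a b"
proof -
  have "cbox a b \<noteq> {}"
    using assms box_subset_cbox[of a b] by (auto simp: rectangle_corners_iff_box)
  then show ?thesis
    by (simp add: content_cbox_cart vol_def)
qed

lemma emeasure_cbox_eq_vol:
  assumes "rectangle_corners a b"
  shows "emeasure lborel (cbox a b) = ennreal (vol a b)"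
  using measure_cbox_eq_vol[OF assms] emeasure_lborel_cbox_finite[of a b]
  by (simp add: emeasure_eq_ennreal_measure less_top)

text \<open>Squeezed between \<open>box a b\<close> and \<open>cbox a b\<close>, which have the same
  Lebesgue measure.\<close>

lemma emeasure_rectangle:
  assumes "rectangle_corners a b"
  shows "emeasure lborel (rectangle a b) = ennreal (vol a b)"
proof (rule antisym)
  show "emeasure lborel (rectangle a b) \<le> ennreal (vol a b)"
    unfolding emeasure_cbox_eq_vol[OF assms, symmetric]
    by (intro emeasure_mono rectangle_subset_cbox) auto
  have "emeasure lborel (box a b) = emeasure lborel (cbox a b)"
    by (simp add: emeasure_lborel_box_eq emeasure_lborel_cbox_eq)
  then show "ennreal (vol a b) \<le> emeasure lborel (rectangle a b)"
    unfolding emeasure_cbox_eq_vol[OF assms, symmetric]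
    by (metis emeasure_mono box_subset_rectangle sets_rectangle sets_lborel)
qed

text \<open>A common point of the two rectangles can be pushed upward in every coordinate, halfway
  to the nearer upper face, which puts it in the interior of both. Non-overlapping closed boxes can
  therefore be replaced by disjoint half-open ones.\<close>

lemma disjoint_rectangle_if_disjoint_box:
  assumes "box a b \<inter> box c d = {}"
  shows "rectangle a b \<inter> rectangle c d = {}"
proof (rule ccontr)
  assume "rectangle a b \<inter> rectangle c d \<noteq> {}"
  then obtain x where x: "x \<in> rectangle a b" "x \<in> rectangle c d" by auto
  define y where "y = (\<chi> j. (x $ j + min (b $ j) (d $ j)) / 2)"
  have "a $ j < y $ j \<and> y $ j < b $ j \<and> c $ j < y $ j \<and> y $ j < d $ j" for j
  proof -
    have "a $ j \<le> x $ j" "x $ j < b $ j" "c $ j \<le> x $ j" "x $ j < d $ j"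
      using x by (auto simp: rectangle_def)
    then show ?thesis
      by (simp add: y_def min_def)
  qed
  then have "y \<in> box a b \<inter> box c d"
    by (auto simp: mem_box_cart)
  with assms show False by auto
qed

section \<open>Volume sums, Lebesgue measure and inner measure\<close>

lemma sum_vol_le_emeasure:
  assumes "disjoint_rectangles k a b"
    and "\<And>i. i \<in> {1..k} \<Longrightarrow> rectangle (a i) (b i) \<subseteq> U" and "U \<in> sets borel"
  shows "ennreal (\<Sum>i=1..k. vol (a i) (b i)) \<le> emeasure lborel U"
proof -
  have corners: "rectangle_corners (a i) (b i)" if "i \<in> {1..k}" for i
    using assms(1) that by (auto simp: disjoint_rectangles_def)
  have "ennreal (\<Sum>i=1..k. vol (a i) (b i)) = (\<Sum>i=1..k. ennreal (vol (a i) (b i)))"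
    using corners by (intro sum_ennreal[symmetric] less_imp_le vol_pos)
  also have "\<dots> = (\<Sum>i=1..k. emeasure lborel (rectangle (a i) (b i)))"
    using corners by (intro sum.cong) (auto simp: emeasure_rectangle)
  also have "\<dots> = emeasure lborel (\<Union>i\<in>{1..k}. rectangle (a i) (b i))"
    using assms(1) by (intro sum_emeasure) (auto simp: disjoint_rectangles_def)
  also have "\<dots> \<le> emeasure lborel U"
    by (intro emeasure_mono UN_least assms(2)) (use assms(3) in auto)
  finally show ?thesis .
qed

text \<open>Disjoint rectangles inside \<open>U\<close> have total Lebesgue measure at most that of
  \<open>U\<close>. Through this inequality the Lebesgue bound on the exceptional set becomes a
  bound on its inner measure.\<close>

lemma inner_measure_le_emeasure:
  assumes "open U"
  shows "inner_measure U \<le> emeasure lborel U"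
  unfolding inner_measure_def
proof (rule Sup_least, clarify)
  fix k a b
  assume disj: "disjoint_rectangles k a b"
    and sub: "\<forall>i\<in>{1..k}. closure (rectangle (a i) (b i)) \<subseteq> U"
  show "ennreal (\<Sum>i=1..k. vol (a i) (b i)) \<le> emeasure lborel U"
  proof (rule sum_vol_le_emeasure[OF disj])
    show "rectangle (a i) (b i) \<subseteq> U" if "i \<in> {1..k}" for i
      using sub that closure_subset[of "rectangle (a i) (b i)"] by blast
  qed (use assms in auto)
qed

text \<open>Scaling about the lower corner \<open>a\<close> moves only the upper corner. The upper
  faces are the ones missing from a half-open rectangle, so pulling them in is enough for the
  closure to fit.\<close>

lemma shrunk_rectangle:
  fixes a b :: "real ^ 'd"
  assumes "rectangle_corners a b" "0 < t" "t < 1"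
  defines "b' \<equiv> a + t *\<^sub>R (b - a)"
  shows "rectangle_corners a b'" "closure (rectangle a b') \<subseteq> rectangle a b"
    and "vol a b' = t ^ CARD('d) * vol a b"
proof -
  show "rectangle_corners a b'"
    using assms by (auto simp: rectangle_corners_def)
  have "b' $ j < b $ j" for j
  proof -
    have "t * (b $ j - a $ j) < 1 * (b $ j - a $ j)"
      using assms by (intro mult_strict_right_mono) (auto simp: rectangle_corners_def)
    then show ?thesis by (simp add: b'_def)
  qed
  then have "cbox a b' \<subseteq> rectangle a b"
    unfolding rectangle_def mem_box_cart subset_iff mem_Collect_eq by (meson le_less_trans)
  moreover have "closure (rectangle a b') \<subseteq> cbox a b'"
    by (intro closure_minimal rectangle_subset_cbox closed_cbox)
  ultimately show "closure (rectangle a b') \<subseteq> rectangle a b" by blast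
  show "vol a b' = t ^ CARD('d) * vol a b"
    by (simp add: vol_def b'_def prod.distrib)
qed

text \<open>Unlike in the definition of \<open>inner_measure\<close>, only the rectangles themselves, not their
  closures, are required to lie in \<open>U\<close>.\<close>

lemma sum_vol_le_inner_measure:
  fixes a b :: "nat \<Rightarrow> real ^ 'd"
  assumes disj: "disjoint_rectangles k a b"
    and sub: "\<And>i. i \<in> {1..k} \<Longrightarrow> rectangle (a i) (b i) \<subseteq> U"
    and le: "inner_measure U \<le> ennreal \<epsilon>" and "0 \<le> \<epsilon>"
  shows "(\<Sum>i=1..k. vol (a i) (b i)) \<le> \<epsilon>"
proof -
  let ?S = "\<Sum>i=1..k. vol (a i) (b i)"
  have corners: "rectangle_corners (a i) (b i)" if "i \<in> {1..k}" for i
    using disj that by (auto simp: disjoint_rectangles_def)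
  have shrunk: "t ^ CARD('d) * ?S \<le> \<epsilon>" if t: "0 < t" "t < 1" for t
  proof -
    define b' where "b' i = a i + t *\<^sub>R (b i - a i)" for i
    have b': "rectangle_corners (a i) (b' i)" "closure (rectangle (a i) (b' i)) \<subseteq> rectangle (a i) (b i)"
        "vol (a i) (b' i) = t ^ CARD('d) * vol (a i) (b i)" if "i \<in> {1..k}" for i
      using shrunk_rectangle[OF corners[OF that] t] by (auto simp: b'_def)
    have "rectangle (a i) (b' i) \<subseteq> rectangle (a i) (b i)" if "i \<in> {1..k}" for i
      using b'(2)[OF that] closure_subset by blast
    then have "disjoint_rectangles k a b'"
      using disj b'(1) unfolding disjoint_rectangles_def disjoint_family_on_def by blast
    moreover have "\<forall>i\<in>{1..k}. closure (rectangle (a i) (b' i)) \<subseteq> U"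
      using b'(2) sub by blast
    ultimately have "ennreal (\<Sum>i=1..k. vol (a i) (b' i)) \<le> inner_measure U"
      unfolding inner_measure_def by (intro Sup_upper) blast
    also have "(\<Sum>i=1..k. vol (a i) (b' i)) = t ^ CARD('d) * ?S"
      by (simp add: b'(3) sum_distrib_left)
    finally show ?thesis
      using le \<open>0 \<le> \<epsilon>\<close> by (meson ennreal_le_iff order_trans)
  qed
  \<comment> \<open>Letting \<open>t\<close> tend to 1 from below recovers the volumes of the
    original rectangles.\<close>
  have "((\<lambda>t. t ^ CARD('d) * ?S) \<longlongrightarrow> 1 ^ CARD('d) * ?S) (at_left (1::real))"
    by (intro tendsto_intros)
  moreover have "eventually (\<lambda>t. t ^ CARD('d) * ?S \<le> \<epsilon>) (at_left (1::real))"
    using eventually_at_left_real[of 0 "1::real"] by (rule eventually_mono) (use shrunk in auto)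
  ultimately have "1 ^ CARD('d) * ?S \<le> \<epsilon>"
    by (rule tendsto_upperbound) (rule trivial_limit_at_left_real)
  then show ?thesis
    by (simp only: power_one mult_1)
qed

section \<open>From finite families of rectangles to the measure of a union of open sets\<close>

lemma emeasure_incseq_le:
  assumes "range A \<subseteq> sets M" "incseq A" "\<And>n. emeasure M (A n) \<le> B"
  shows "emeasure M (\<Union>n. A n) \<le> B"
  using assms SUP_emeasure_incseq[OF assms(1,2)] by (metis SUP_least)

text \<open>A bounded piece of the union is covered by countably many non-overlapping boxes, each
  inside a single member of \<open>\<G>\<close>. Finitely many of them give disjoint rectangles to
  which \<open>bound\<close> applies, and continuity from below passes first to all the boxes and
  then to the whole union.\<close>

lemma emeasure_le_if_sum_vol_le:
  fixes \<G> :: "(real ^ 'd) set set"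
  assumes op: "\<And>G. G \<in> \<G> \<Longrightarrow> open G"
    and bound: "\<And>k a b. disjoint_rectangles k a b \<Longrightarrow>
      \<forall>i\<in>{1..k}. \<exists>G\<in>\<G>. rectangle (a i) (b i) \<subseteq> G \<Longrightarrow> (\<Sum>i=1..k. vol (a i) (b i)) \<le> \<epsilon>"
  shows "emeasure lborel (\<Union>\<G>) \<le> ennreal \<epsilon>"
proof -
  \<comment> \<open>The covering lemma works inside one box with nonempty interior;
    \<open>Suc n\<close> keeps that box nondegenerate at \<open>n = 0\<close>.\<close>
  define S where "S n = \<Union>\<G> \<inter> cbox (- (\<chi> i. real (Suc n))) (\<chi> i. real (Suc n))" for n
  have "0 \<le> \<epsilon>"
    using bound[of 0] by (simp add: disjoint_rectangles_def disjoint_family_on_def)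
  \<comment> \<open>The value \<open>UNIV\<close> only makes \<open>g\<close> a gauge on the whole
    space: the boxes obtained below are attached to points of \<open>S n\<close>, where
    \<open>g\<close> selects a member of \<open>\<G>\<close>.\<close>
  define g where "g x = (if x \<in> \<Union>\<G> then SOME G. G \<in> \<G> \<and> x \<in> G else UNIV)" for x
  have g: "g x \<in> \<G> \<and> x \<in> g x" if "x \<in> \<Union>\<G>" for x
    using that someI_ex[of "\<lambda>G. G \<in> \<G> \<and> x \<in> G"] unfolding g_def by auto
  have "gauge g"
    unfolding gauge_def
  proof (intro allI conjI)
    fix x
    show "x \<in> g x" "open (g x)"
      using g[of x] op by (cases "x \<in> \<Union>\<G>"; auto simp: g_def)+
  qed
  have S_le: "emeasure lborel (S n) \<le> ennreal \<epsilon>" for n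
  proof -
    have "S n \<subseteq> cbox (- (\<chi> i. real (Suc n))) (\<chi> i. real (Suc n))"
      by (simp add: S_def)
    moreover have "box (- (\<chi> i. real (Suc n))) (\<chi> i. real (Suc n)) \<noteq> ({} :: (real ^ 'd) set)"
      by (simp add: interval_ne_empty_cart)
    ultimately obtain \<D> where \<D>: "countable \<D>"
        "\<And>K. K \<in> \<D> \<Longrightarrow> interior K \<noteq> {} \<and> (\<exists>c d. K = cbox c d)"
        "pairwise (\<lambda>A B. interior A \<inter> interior B = {}) \<D>"
        "\<And>K. K \<in> \<D> \<Longrightarrow> \<exists>x \<in> S n \<inter> K. K \<subseteq> g x" "S n \<subseteq> \<Union>\<D>"
      by (rule covering_lemma[OF _ _ \<open>gauge g\<close>]) blast
    obtain l u where lu: "\<And>K. K \<in> \<D> \<Longrightarrow> K = cbox (l K) (u K)"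
      using \<D>(2) by metis
    have int: "interior K = box (l K) (u K)" if "K \<in> \<D>" for K
      using lu[OF that] by (metis interior_cbox)
    have fm: "K \<in> fmeasurable lborel" if "K \<in> \<D>" for K
      using lu[OF that] by (metis fmeasurable_cbox)
    have fin: "measure lborel (\<Union>\<E>) \<le> \<epsilon>" if \<E>: "\<E> \<subseteq> \<D>" "finite \<E>" for \<E>
    proof -
      obtain h where h: "bij_betw h {1..card \<E>} \<E>"
        using ex_bij_betw_nat_finite_1[OF \<E>(2)] by blast
      have h\<D>: "h i \<in> \<D>" if "i \<in> {1..card \<E>}" for i
        using bij_betwE[OF h] that \<E>(1) by blast
      have corners: "rectangle_corners (l K) (u K)" if "K \<in> \<D>" for K
        using int[OF that] \<D>(2)[OF that] by (simp add: rectangle_corners_iff_box)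
      have "disjoint_rectangles (card \<E>) (l \<circ> h) (u \<circ> h)"
        unfolding disjoint_rectangles_def disjoint_family_on_def o_def
      proof (intro conjI ballI impI)
        fix i j assume ij: "i \<in> {1..card \<E>}" "j \<in> {1..card \<E>}" "i \<noteq> j"
        then have "h i \<noteq> h j"
          using inj_onD[OF bij_betw_imp_inj_on[OF h]] by blast
        then have "interior (h i) \<inter> interior (h j) = {}"
          using \<D>(3) h\<D> ij by (auto simp: pairwise_def)
        then show "rectangle (l (h i)) (u (h i)) \<inter> rectangle (l (h j)) (u (h j)) = {}"
          using int h\<D> ij by (intro disjoint_rectangle_if_disjoint_box) auto
      qed (use corners h\<D> in auto)
      moreover have "\<forall>i\<in>{1..card \<E>}. \<exists>G\<in>\<G>. rectangle ((l \<circ> h) i) ((u \<circ> h) i) \<subseteq> G"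
      proof
        fix i assume "i \<in> {1..card \<E>}"
        then have K: "h i \<in> \<D>" by (rule h\<D>)
        obtain x where "x \<in> S n" "h i \<subseteq> g x"
          using \<D>(4)[OF K] by auto
        moreover have "rectangle ((l \<circ> h) i) ((u \<circ> h) i) \<subseteq> h i"
          using lu[OF K] rectangle_subset_cbox[of "l (h i)" "u (h i)"] by (metis o_apply)
        moreover have "g x \<in> \<G>"
          using g[of x] \<open>x \<in> S n\<close> by (simp add: S_def)
        ultimately show "\<exists>G\<in>\<G>. rectangle ((l \<circ> h) i) ((u \<circ> h) i) \<subseteq> G"
          by blast
      qed
      ultimately have le: "(\<Sum>i=1..card \<E>. vol ((l \<circ> h) i) ((u \<circ> h) i)) \<le> \<epsilon>"
        by (rule bound)
      \<comment> \<open>Subadditivity suffices here; the disjointness of the interiors has gone into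
        \<open>le\<close>.\<close>
      have "measure lborel (\<Union>K\<in>\<E>. K) \<le> (\<Sum>K\<in>\<E>. measure lborel K)"
        using \<E> fm by (intro measure_UNION_le fmeasurableD) blast+
      also have "\<dots> = (\<Sum>K\<in>\<E>. vol (l K) (u K))"
        using lu measure_cbox_eq_vol[OF corners] \<E>(1) by (intro sum.cong refl) (metis subsetD)
      also have "\<dots> = (\<Sum>i=1..card \<E>. vol ((l \<circ> h) i) ((u \<circ> h) i))"
        using sum.reindex_bij_betw[OF h, of "\<lambda>K. vol (l K) (u K)"] by simp
      also note le
      finally show ?thesis
        by (simp only: image_ident)
    qed
    have "\<Union>\<D> \<in> fmeasurable lborel" "measure lborel (\<Union>\<D>) \<le> \<epsilon>"
      using fmeasurable_Union_bound[OF \<D>(1) fm fin] measure_Union_bound[OF \<D>(1) fm fin] by auto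
    then have "emeasure lborel (\<Union>\<D>) \<le> ennreal \<epsilon>"
      by (simp add: emeasure_eq_measure2 ennreal_leI)
    moreover have "emeasure lborel (S n) \<le> emeasure lborel (\<Union>\<D>)"
      using \<D>(5) \<open>\<Union>\<D> \<in> fmeasurable lborel\<close> by (intro emeasure_mono) (auto dest: fmeasurableD)
    ultimately show ?thesis by order
  qed
  have "\<exists>n. x \<in> S n" if "x \<in> \<Union>\<G>" for x
  proof -
    obtain n where n: "norm x \<le> real n"
      using real_arch_simple by blast
    have "- real (Suc n) \<le> x $ j \<and> x $ j \<le> real (Suc n)" for j
      using component_le_norm_cart[of x j] n by auto
    then show ?thesis
      using that by (auto simp: S_def mem_box_cart intro!: exI[of _ n])
  qed
  then have "(\<Union>n. S n) = \<Union>\<G>"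
    by (auto simp: S_def)
  moreover have "emeasure lborel (\<Union>n. S n) \<le> ennreal \<epsilon>"
  proof (rule emeasure_incseq_le[OF _ _ S_le])
    have "\<Union>\<G> \<in> sets borel"
      using op by (intro borel_open open_Union) auto
    then show "range S \<subseteq> sets lborel"
      by (auto simp: S_def)
    show "incseq S"
    proof (rule incseq_SucI)
      fix n
      show "S n \<subseteq> S (Suc n)"
        unfolding S_def by (intro Int_mono order_refl) (auto simp: subset_interval_cart)
    qed
  qed
  ultimately show ?thesis by simp
qed

section \<open>Gauge measurability gives continuity off a small open set\<close>

lemma gauge_measurable_imp_small_exceptional_set:
  assumes "gauge_measurable f" "0 < \<epsilon>" "0 < \<eta>"
  obtains U \<gamma> where "open U" "emeasure lborel U \<le> ennreal \<epsilon>" "gauge \<gamma>"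
    "\<And>x y. x \<notin> U \<Longrightarrow> y \<notin> U \<Longrightarrow> y \<in> \<gamma> x \<Longrightarrow> norm (f x - f y) < \<eta>"
proof -
  obtain \<gamma> where \<gamma>: "gauge \<gamma>"
    and fine: "\<forall>k a b c c'. disjoint_rectangles k a b \<and>
      (\<forall>i\<in>{1..k}. norm (f (c i) - f (c' i)) \<ge> \<eta> \<and> rectangle (a i) (b i) \<subseteq> \<gamma> (c i) \<inter> \<gamma> (c' i))
      \<longrightarrow> (\<Sum>i=1..k. vol (a i) (b i)) \<le> \<epsilon>"
    using assms(1)[unfolded gauge_measurable_def, rule_format, OF assms(2,3)] by (elim exE conjE)
  define \<G> where "\<G> = {\<gamma> c \<inter> \<gamma> c' | c c'. norm (f c - f c') \<ge> \<eta>}"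
  have op: "open G" if "G \<in> \<G>" for G
    using that \<gamma> by (auto simp: \<G>_def gauge_def)
  have "emeasure lborel (\<Union>\<G>) \<le> ennreal \<epsilon>"
  \<comment> \<open>A rectangle inside a member of \<open>\<G>\<close> comes with a pair
    \<open>c\<close>, \<open>c'\<close> as in the definition of gauge measurability, so
    \<open>fine\<close> is the required bound.\<close>
  proof (rule emeasure_le_if_sum_vol_le[OF op])
    fix k a b
    assume disj: "disjoint_rectangles k a b" and "\<forall>i\<in>{1..k}. \<exists>G\<in>\<G>. rectangle (a i) (b i) \<subseteq> G"
    then have "\<forall>i\<in>{1..k}. \<exists>c c'. norm (f c - f c') \<ge> \<eta> \<and> rectangle (a i) (b i) \<subseteq> \<gamma> c \<inter> \<gamma> c'"
      unfolding \<G>_def by blast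
    then obtain c c' where
      "\<forall>i\<in>{1..k}. norm (f (c i) - f (c' i)) \<ge> \<eta> \<and> rectangle (a i) (b i) \<subseteq> \<gamma> (c i) \<inter> \<gamma> (c' i)"
      by metis
    with disj show "(\<Sum>i=1..k. vol (a i) (b i)) \<le> \<epsilon>"
      using fine by blast
  qed
  moreover have "norm (f x - f y) < \<eta>" if "y \<notin> \<Union>\<G>" "y \<in> \<gamma> x" for x y
  proof (rule ccontr)
    assume "\<not> norm (f x - f y) < \<eta>"
    then have "\<gamma> x \<inter> \<gamma> y \<in> \<G>"
      unfolding \<G>_def not_less by blast
    moreover have "y \<in> \<gamma> y"
      using \<gamma> by (simp add: gauge_def)
    ultimately show False
      using that by blast
  qed
  moreover have "open (\<Union>\<G>)"
    using op by blast
  ultimately show ?thesis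
    using that[of "\<Union>\<G>" \<gamma>] \<gamma> by blast
qed

lemma gauge_measurable_imp_lusin:
  assumes "gauge_measurable f" "0 < \<epsilon>"
  shows "\<exists>C. closed C \<and> continuous_on C f \<and> inner_measure (UNIV - C) \<le> ennreal \<epsilon>"
proof -
  \<comment> \<open>The exponent \<open>Suc n\<close> makes the measure bounds sum to exactly
    \<open>\<epsilon>\<close>, while the oscillation bounds tend to 0.\<close>
  have "0 < \<epsilon> * (1/2) ^ Suc n" "0 < 1 / real (Suc n)" for n
    using assms(2) by auto
  from gauge_measurable_imp_small_exceptional_set[OF assms(1) this]
  have "\<exists>U \<gamma>. open U \<and> emeasure lborel U \<le> ennreal (\<epsilon> * (1/2) ^ Suc n) \<and> gauge \<gamma> \<and>
      (\<forall>x y. x \<notin> U \<longrightarrow> y \<notin> U \<longrightarrow> y \<in> \<gamma> x \<longrightarrow> norm (f x - f y) < 1 / Suc n)" for n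
    by metis
  then obtain U \<gamma> where U: "\<And>n. open (U n)"
      "\<And>n. emeasure lborel (U n) \<le> ennreal (\<epsilon> * (1/2) ^ Suc n)"
    and \<gamma>: "\<And>n. gauge (\<gamma> n)"
      "\<And>n x y. x \<notin> U n \<Longrightarrow> y \<notin> U n \<Longrightarrow> y \<in> \<gamma> n x \<Longrightarrow> norm (f x - f y) < 1 / Suc n"
    by metis
  define V where "V = (\<Union>n. U n)"
  have "open V"
    using U(1) by (auto simp: V_def)
  have "(\<lambda>n. \<epsilon> * (1/2) ^ Suc n) sums (\<epsilon> * 1)"
    by (intro sums_mult power_half_series)
  then have "(\<Sum>n. ennreal (\<epsilon> * (1/2) ^ Suc n)) = ennreal \<epsilon>"
    using assms(2) by (subst suminf_ennreal_eq[where x = \<epsilon>]) auto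
  moreover have "emeasure lborel V \<le> (\<Sum>n. emeasure lborel (U n))"
    unfolding V_def using U(1) by (intro emeasure_subadditive_countably) auto
  moreover have "(\<Sum>n. emeasure lborel (U n)) \<le> (\<Sum>n. ennreal (\<epsilon> * (1/2) ^ Suc n))"
    using U(2) by (intro suminf_le) auto
  ultimately have "inner_measure V \<le> ennreal \<epsilon>"
    using inner_measure_le_emeasure[OF \<open>open V\<close>] by (metis order_trans)
  moreover have "continuous_on (- V) f"
    unfolding continuous_on_topological
  proof (intro ballI allI impI)
    fix x B assume x: "x \<in> - V" and B: "open B" "f x \<in> B"
    then obtain e where e: "0 < e" "ball (f x) e \<subseteq> B"
      by (meson open_contains_ball)
    obtain n where n: "1 / Suc n < e"
      using reals_Archimedean[OF e(1)] by (auto simp: inverse_eq_divide)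
    \<comment> \<open>The open set \<open>\<gamma> n x\<close> serves as the neighbourhood of
      \<open>x\<close> for continuity relative to \<open>- V\<close>.\<close>
    have "f y \<in> B" if "y \<in> - V" "y \<in> \<gamma> n x" for y
    proof -
      have "norm (f x - f y) < 1 / Suc n"
        using \<gamma>(2) x that by (auto simp: V_def)
      then show ?thesis
        using e(2) n by (auto simp: dist_norm)
    qed
    then show "\<exists>A. open A \<and> x \<in> A \<and> (\<forall>y\<in>- V. y \<in> A \<longrightarrow> f y \<in> B)"
      using \<gamma>(1)[of n] by (auto simp: gauge_def intro!: exI[of _ "\<gamma> n x"])
  qed
  ultimately show ?thesis
    using \<open>open V\<close> by (auto simp: Compl_eq_Diff_UNIV[symmetric] intro!: exI[of _ "- V"])
qed

section \<open>Continuity on large closed sets gives gauge measurability\<close>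

lemma lusin_imp_gauge_measurable:
  fixes f :: "real ^ 'd \<Rightarrow> real ^ 'p"
  assumes lusin: "\<And>\<epsilon>::real. 0 < \<epsilon> \<Longrightarrow>
    \<exists>C. closed C \<and> continuous_on C f \<and> inner_measure (UNIV - C) \<le> ennreal \<epsilon>"
  shows "gauge_measurable f"
  unfolding gauge_measurable_def
proof (intro allI impI)
  fix \<epsilon> \<eta> :: real assume pos: "0 < \<epsilon>" "0 < \<eta>"
  obtain C where C: "closed C" "continuous_on C f" "inner_measure (UNIV - C) \<le> ennreal \<epsilon>"
    using lusin[OF pos(1)] by blast
  have "\<exists>A. open A \<and> x \<in> A \<and>
      (if x \<in> C then \<forall>y\<in>C. y \<in> A \<longrightarrow> norm (f x - f y) < \<eta> / 2 else A = - C)" for x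
  proof (cases "x \<in> C")
    case True
    have "open (ball (f x) (\<eta> / 2))" "f x \<in> ball (f x) (\<eta> / 2)"
      using pos(2) by auto
    then obtain A where "open A" "x \<in> A" "\<forall>y\<in>C. y \<in> A \<longrightarrow> f y \<in> ball (f x) (\<eta> / 2)"
      using C(2) True unfolding continuous_on_topological by meson
    then show ?thesis
      using True by (auto simp: dist_norm)
  qed (use C(1) in auto)
  then obtain \<gamma> where \<gamma>: "\<And>x. open (\<gamma> x)" "\<And>x. x \<in> \<gamma> x"
      "\<And>x. if x \<in> C then \<forall>y\<in>C. y \<in> \<gamma> x \<longrightarrow> norm (f x - f y) < \<eta> / 2 else \<gamma> x = - C"
    by metis
  \<comment> \<open>If \<open>y\<close> were in \<open>C\<close>, then neither
    \<open>\<gamma> c\<close> nor \<open>\<gamma> c'\<close> could be \<open>- C\<close>, so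
    \<open>c\<close> and \<open>c'\<close> lie in \<open>C\<close>. Both values of \<open>f\<close>
    are then within \<open>\<eta> / 2\<close> of \<open>f y\<close>, against the assumed
    gap.\<close>
  have miss: "y \<notin> C" if "norm (f c - f c') \<ge> \<eta>" "y \<in> \<gamma> c" "y \<in> \<gamma> c'" for y c c'
  proof
    assume "y \<in> C"
    then have "norm (f c - f y) < \<eta> / 2" "norm (f c' - f y) < \<eta> / 2"
      using \<gamma>(3)[of c] \<gamma>(3)[of c'] that by (auto split: if_splits)
    then have "norm (f c - f c') < \<eta>"
      using norm_triangle_half_l by blast
    with that(1) show False by simp
  qed
  show "\<exists>\<gamma>. gauge \<gamma> \<and> (\<forall>k a b c c'. disjoint_rectangles k a b \<and>
      (\<forall>i\<in>{1..k}. norm (f (c i) - f (c' i)) \<ge> \<eta> \<and> rectangle (a i) (b i) \<subseteq> \<gamma> (c i) \<inter> \<gamma> (c' i)) \<longrightarrow>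
      (\<Sum>i=1..k. vol (a i) (b i)) \<le> \<epsilon>)"
  proof (intro exI[of _ \<gamma>] conjI allI impI; (elim conjE)?)
    show "gauge \<gamma>"
      using \<gamma> by (auto simp: gauge_def)
    fix k a b c c'
    assume disj: "disjoint_rectangles k a b"
      and "\<forall>i\<in>{1..k}. norm (f (c i) - f (c' i)) \<ge> \<eta> \<and>
        rectangle (a i) (b i) \<subseteq> \<gamma> (c i) \<inter> \<gamma> (c' i)"
    then have "rectangle (a i) (b i) \<subseteq> UNIV - C" if "i \<in> {1..k}" for i
      using miss that by blast
    \<comment> \<open>The rectangles avoid \<open>C\<close> but their closures may meet it, so the
      supremum defining \<open>inner_measure\<close> is reached through
      \<open>sum_vol_le_inner_measure\<close>.\<close>
    with disj show "(\<Sum>i=1..k. vol (a i) (b i)) \<le> \<epsilon>"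
      using C(3) pos(1) by (intro sum_vol_le_inner_measure) auto
  qed
qed

theorem proposition4p1:
  fixes f :: "real ^ 'd \<Rightarrow> real ^ 'p"
  shows "gauge_measurable f \<longleftrightarrow>
    (\<forall>\<epsilon>::real. \<epsilon> > 0 \<longrightarrow>
      (\<exists>C. closed C \<and> continuous_on C f \<and> inner_measure (UNIV - C) \<le> ennreal \<epsilon>))"
  using gauge_measurable_imp_lusin lusin_imp_gauge_measurable by blast

end
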